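(* Let $X,Y$ be real Hilbert spaces, $A\in L(X,Y)$, and let $R\colon X\to[0,\infty]$ be convex, coercive and weakly lower semicontinuous with $R\not\equiv\infty$. Then for all $y^\delta\in Y$ with $y^\delta\neq 0$ and all $\alpha>0$, the problem $$\min_{x\in X}\ \frac12\|Ax-y^\delta\|^2\quad\text{s.t.}\quad \exists\, v\in\partial R(x):\ \alpha\langle v,x\rangle\le\frac{\|y^\delta\|^2}{4}$$ is equivalent to the ADP problem $$\min_{B\in L(X,Y)}\ \frac12\|Ax(B)-y^\delta\|^2\quad\text{s.t.}\quad x(B)=\arg\min_{x\in X}\ \frac12\|Bx-y^\delta\|^2+\alpha R(x).$$ That is, the set of admissible elements $x$ of the first problem coincides with the set of $\hat x\in X$ for which there is $B\in L(X,Y)$ such that $\hat x$ is a minimizer of $x\mapsto\frac12\|Bx-y^\delta\|^2+\alpha R(x)$; hence both problems minimize the same objective $\frac12\|Ax-y^\delta\|^2$ over the same set of elements $x$ and have the same solutions $x$.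
   Context: $L(X,Y)$ is the space of bounded linear operators from $X$ to $Y$. $\partial R(x)=\{v\in X: R(z)\ge R(x)+\langle v,z-x\rangle\ \forall z\in X\}$ is the convex subdifferential if $R(x)<\infty$, and $\partial R(x)=\emptyset$ if $R(x)=\infty$. Coercive means $R(x)\to\infty$ as $\|x\|\to\infty$. An element $\hat x\in X$ is called a solution of the ADP problem if it minimizes $\frac12\|Ax-y^\delta\|^2$ over the set $U_{\alpha R}$ of all $\hat x\in X$ such that, for some $B\in L(X,Y)$, $\hat x$ is a minimizer of $x\mapsto \frac12\|Bx-y^\delta\|^2+\alpha R(x)$. Since $R$ need not be strictly convex, "$\hat x=\arg\min$" is read as "$\hat x$ is a minimizer". *)

theory Defs
  imports "HOL-Analysis.Analysis"
begin

text \<open>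
  Functionals with values in the extended reals have codomain \<open>ereal\<close>. The notions below are
  used for functionals that are bounded below by \<open>0\<close>, so \<open>\<infinity> - \<infinity>\<close> never occurs; recall that
  \<open>0 * \<infinity> = 0\<close> in \<open>ereal\<close>.
\<close>

definition convex_functional :: "('a::real_vector \<Rightarrow> ereal) \<Rightarrow> bool" where
  "convex_functional R \<longleftrightarrow>
     (\<forall>x y. \<forall>u\<ge>0. \<forall>v\<ge>0. u + v = 1 \<longrightarrow>
        R (u *\<^sub>R x + v *\<^sub>R y) \<le> ereal u * R x + ereal v * R y)"

definition coercive :: "('a::real_normed_vector \<Rightarrow> ereal) \<Rightarrow> bool" where
  "coercive R \<longleftrightarrow> (R \<longlongrightarrow> \<infinity>) at_infinity"

text \<open>The coarsest topology for which all bounded linear functionals are continuous.\<close>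

definition weak_topology :: "'a::real_normed_vector topology" where
  "weak_topology =
     topology_generated_by {blinfun_apply \<phi> -` U | (\<phi> :: 'a \<Rightarrow>\<^sub>L real) U. open U}"

definition weakly_lsc :: "('a::real_normed_vector \<Rightarrow> ereal) \<Rightarrow> bool" where
  "weakly_lsc R \<longleftrightarrow> (\<forall>c. closedin weak_topology {x. R x \<le> c})"

definition subdifferential :: "('a::real_inner \<Rightarrow> ereal) \<Rightarrow> 'a \<Rightarrow> 'a set" where
  "subdifferential R x =
     (if R x = \<infinity> then {} else {v. \<forall>z. R z \<ge> R x + ereal (inner v (z - x))})"

definition tikhonov ::
  "('a::real_normed_vector \<Rightarrow> ereal) \<Rightarrow> real \<Rightarrow> 'b::real_normed_vector \<Rightarrow> ('a \<Rightarrow>\<^sub>L 'b) \<Rightarrow> 'a \<Rightarrow> ereal"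
where
  "tikhonov R \<alpha> y B x = ereal (1 / 2 * (norm (blinfun_apply B x - y))\<^sup>2) + ereal \<alpha> * R x"

text \<open>The set \<open>U\<^bsub>\<alpha>R\<^esub>\<close> of all minimizers \<open>x(B)\<close>. As \<open>R\<close> need not be strictly convex,
  \<open>x(B)\<close> is any minimizer, and an operator \<open>B\<close> without minimizer contributes nothing.\<close>

definition adp_feasible ::
  "('a::real_normed_vector \<Rightarrow> ereal) \<Rightarrow> real \<Rightarrow> 'b::real_normed_vector \<Rightarrow> 'a set" where
  "adp_feasible R \<alpha> y =
     {x. \<exists>B :: 'a \<Rightarrow>\<^sub>L 'b. is_arg_min (tikhonov R \<alpha> y B) (\<lambda>_. True) x}"

definition adp_solution ::
  "('a::real_normed_vector \<Rightarrow>\<^sub>L 'b::real_normed_vector) \<Rightarrow> ('a \<Rightarrow> ereal) \<Rightarrow> real \<Rightarrow> 'b \<Rightarrow> 'a \<Rightarrow> bool"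
where
  "adp_solution A R \<alpha> y =
     is_arg_min (\<lambda>x. 1 / 2 * (norm (blinfun_apply A x - y))\<^sup>2) (\<lambda>x. x \<in> adp_feasible R \<alpha> y)"

definition subgrad_feasible ::
  "('a::real_inner \<Rightarrow> ereal) \<Rightarrow> real \<Rightarrow> 'b::real_normed_vector \<Rightarrow> 'a set" where
  "subgrad_feasible R \<alpha> y =
     {x. \<exists>v\<in>subdifferential R x. \<alpha> * inner v x \<le> (norm y)\<^sup>2 / 4}"

definition subgrad_solution ::
  "('a::real_inner \<Rightarrow>\<^sub>L 'b::real_normed_vector) \<Rightarrow> ('a \<Rightarrow> ereal) \<Rightarrow> real \<Rightarrow> 'b \<Rightarrow> 'a \<Rightarrow> bool"
where
  "subgrad_solution A R \<alpha> y =
     is_arg_min (\<lambda>x. 1 / 2 * (norm (blinfun_apply A x - y))\<^sup>2) (\<lambda>x. x \<in> subgrad_feasible R \<alpha> y)"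

end

theory Submission
  imports Defs
begin

text \<open>
  The two admissible sets coincide because both constraints express the optimality condition
  \<open>\<alpha> v = B\<^sup>* (y - B x)\<close> with \<open>v \<in> \<partial>R(x)\<close>.

  If \<open>x\<close> minimizes the Tikhonov functional of \<open>B\<close>, comparing \<open>x\<close> with points on the segment to an
  arbitrary \<open>z\<close> shows that \<open>v = B\<^sup>* (y - B x) / \<alpha>\<close> is a subgradient of \<open>R\<close> at \<open>x\<close>; its existence as
  an element of the Hilbert space is the Riesz representation theorem. Then
  \<open>\<alpha> \<langle>v, x\<rangle> = \<langle>y - B x, B x\<rangle> \<le> \<parallel>y\<parallel>\<^sup>2 / 4\<close> follows by completing the square.

  Conversely, given a subgradient \<open>v\<close>, the rank one operator \<open>B z = b \<langle>v, z\<rangle> y\<close> satisfies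
  \<open>B\<^sup>* (y - B x) = b \<parallel>y\<parallel>\<^sup>2 (1 - b \<langle>v, x\<rangle>) v\<close>. The factor of \<open>v\<close> equals \<open>\<alpha>\<close> for a suitable real \<open>b\<close>,
  since the discriminant of this equation in \<open>b\<close>, which is quadratic unless \<open>\<langle>v, x\<rangle> = 0\<close>, is
  nonnegative precisely when \<open>\<alpha> \<langle>v, x\<rangle> \<le> \<parallel>y\<parallel>\<^sup>2 / 4\<close>. By convexity, the optimality condition makes
  \<open>x\<close> a minimizer of the Tikhonov functional of \<open>B\<close>.
\<close>

lemma nonneg_if_quadratic_nonneg_near_0:
  fixes c d :: real
  assumes "\<And>t. 0 < t \<Longrightarrow> t \<le> 1 \<Longrightarrow> 0 \<le> t * c + t\<^sup>2 * d"
  shows "0 \<le> c"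
proof (rule tendsto_lowerbound)
  show "((\<lambda>t. c + t * d) \<longlongrightarrow> c) (at_right 0)"
    by (auto intro!: tendsto_eq_intros)
  have "0 \<le> c + t * d" if "0 < t" "t < 1" for t
  proof -
    have "0 \<le> t * (c + t * d)"
      using assms[of t] that by (simp add: algebra_simps power2_eq_square)
    then show ?thesis
      using that by (simp add: zero_le_mult_iff)
  qed
  then show "\<forall>\<^sub>F t in at_right 0. 0 \<le> c + t * d"
    unfolding eventually_at_right_field by (intro exI[of _ 1]) auto
qed simp

text \<open>The representing vector is the minimizer of \<open>\<parallel>z\<parallel>\<^sup>2 - 2 f z\<close>. Minimizing sequences are Cauchy
  by the parallelogram law.\<close>

lemma riesz_representation:
  fixes f :: "'a::{real_inner, complete_space} \<Rightarrow> real"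
  assumes f: "bounded_linear f"
  obtains v where "\<And>z. f z = inner v z"
proof -
  interpret f: bounded_linear f by (fact f)
  define q where "q z = (norm z)\<^sup>2 - 2 * f z" for z
  obtain K where K: "\<And>z. norm (f z) \<le> norm z * K"
    using f.bounded by blast
  have q_ge: "- K\<^sup>2 \<le> q z" for z
  proof -
    have "0 \<le> (norm z - K)\<^sup>2" by simp
    then show ?thesis
      using K[of z] by (simp add: q_def power2_eq_square algebra_simps)
  qed
  define m where "m = (INF z. q z)"
  have bdd: "bdd_below (range q)"
    using q_ge by (intro bdd_belowI[of _ "- K\<^sup>2"]) auto
  have m_le: "m \<le> q z" for z
    unfolding m_def using bdd by (intro cINF_lower) auto
  have "\<exists>z. q z < m + inverse (real (Suc n))" for n
    using cINF_less_iff[OF _ bdd, of "m + inverse (real (Suc n))"] by (simp add: m_def)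
  then obtain X where X: "\<And>n. q (X n) < m + inverse (real (Suc n))"
    by metis
  have parallelogram: "(norm (a - b))\<^sup>2 = 2 * q a + 2 * q b - 4 * q ((1/2) *\<^sub>R (a + b))" for a b
    by (simp add: q_def power2_norm_eq_inner f.add f.scaleR inner_simps inner_commute[of b a]
        algebra_simps)
  have "Cauchy X"
  proof (rule metric_CauchyI)
    fix e :: real assume e: "0 < e"
    then obtain N where N: "inverse (real (Suc N)) < e\<^sup>2 / 4"
      using reals_Archimedean[of "e\<^sup>2 / 4"] by auto
    have X_N: "q (X n) < m + e\<^sup>2 / 4" if "n \<ge> N" for n
    proof -
      have "inverse (real (Suc n)) \<le> inverse (real (Suc N))"
        using that by (intro le_imp_inverse_le) auto
      then show ?thesis using X[of n] N by linarith
    qed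
    have "dist (X n) (X k) < e" if "n \<ge> N" "k \<ge> N" for n k
    proof -
      have "(norm (X n - X k))\<^sup>2 < e\<^sup>2"
        using parallelogram[of "X n" "X k"] X_N[OF that(1)] X_N[OF that(2)]
          m_le[of "(1/2) *\<^sub>R (X n + X k)"] by linarith
      then show ?thesis
        using e by (simp add: dist_norm power2_less_imp_less)
    qed
    then show "\<exists>M. \<forall>n\<ge>M. \<forall>k\<ge>M. dist (X n) (X k) < e" by blast
  qed
  then obtain v where v: "X \<longlonglongrightarrow> v"
    by (auto simp: Cauchy_convergent_iff convergent_def)
  have "(\<lambda>n. q (X n)) \<longlonglongrightarrow> q v"
    unfolding q_def by (intro tendsto_intros v f.tendsto)
  moreover have "(\<lambda>n. m + inverse (real (Suc n))) \<longlonglongrightarrow> m + 0"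
    by (intro tendsto_intros LIMSEQ_inverse_real_of_nat)
  ultimately have "q v \<le> m + 0"
    by (rule LIMSEQ_le) (use X in \<open>auto intro: less_imp_le\<close>)
  then have q_min: "q v \<le> q z" for z
    using m_le[of z] by linarith
  have le: "f z \<le> inner v z" for z
  proof -
    have "0 \<le> t * (2 * (inner v z - f z)) + t\<^sup>2 * (norm z)\<^sup>2" for t
    proof -
      have "(norm (v + t *\<^sub>R z))\<^sup>2 = (norm v)\<^sup>2 + 2 * t * inner v z + t\<^sup>2 * (norm z)\<^sup>2"
        unfolding power2_norm_eq_inner
        by (simp add: inner_simps inner_commute[of z v] power2_eq_square algebra_simps)
      then show ?thesis
        using q_min[of "v + t *\<^sub>R z"] by (simp add: q_def f.add f.scaleR algebra_simps)
    qed
    then have "0 \<le> 2 * (inner v z - f z)"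
      by (rule nonneg_if_quadratic_nonneg_near_0)
    then show ?thesis by simp
  qed
  have "f z = inner v z" for z
    using le[of z] le[of "- z"] by (simp add: f.neg)
  then show ?thesis by (rule that)
qed

lemma inner_diff_self_le:
  fixes y w :: "'a::real_inner"
  shows "inner (y - w) w \<le> (norm y)\<^sup>2 / 4"
proof -
  have "0 \<le> (norm ((1/2) *\<^sub>R y - w))\<^sup>2" by simp
  also have "\<dots> = (norm y)\<^sup>2 / 4 - inner (y - w) w"
    by (simp add: power2_norm_eq_inner inner_simps inner_commute[of w y] algebra_simps)
  finally show ?thesis by simp
qed

lemma subgrad_feasible_if_adp_feasible:
  fixes R :: "'x::{real_inner, complete_space} \<Rightarrow> ereal" and y :: "'y::real_inner"
  assumes nonneg: "\<And>x. 0 \<le> R x"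
    and conv: "convex_functional R"
    and proper: "\<exists>x. R x \<noteq> \<infinity>"
    and \<alpha>: "\<alpha> > 0"
    and x: "x \<in> adp_feasible R \<alpha> y"
  shows "x \<in> subgrad_feasible R \<alpha> y"
proof -
  obtain B :: "'x \<Rightarrow>\<^sub>L 'y" where B: "\<And>z. tikhonov R \<alpha> y B x \<le> tikhonov R \<alpha> y B z"
    using x by (auto simp: adp_feasible_def is_arg_min_def not_less)
  have finite_R: "\<exists>r. R z = ereal r" if "R z \<noteq> \<infinity>" for z
    using nonneg[of z] that by (cases "R z") auto
  have "R x \<noteq> \<infinity>"
  proof
    assume "R x = \<infinity>"
    moreover obtain z r where "R z = ereal r"
      using proper finite_R by blast
    ultimately show False
      using B[of z] \<alpha> by (simp add: tikhonov_def)
  qed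
  then obtain rx where rx: "R x = ereal rx"
    using finite_R by blast
  have "bounded_linear (\<lambda>z. inner ((1 / \<alpha>) *\<^sub>R (y - B x)) (B z))"
    by (intro bounded_linear_inner_right_comp blinfun.bounded_linear_right)
  then obtain v where v: "\<And>z. inner ((1 / \<alpha>) *\<^sub>R (y - B x)) (B z) = inner v z"
    by (rule riesz_representation) blast
  then have v': "inner (y - B x) (B z) = \<alpha> * inner v z" for z
  proof -
    have "inner v z = (1 / \<alpha>) * inner (y - B x) (B z)"
      unfolding v[symmetric] inner_scaleR_left ..
    then show ?thesis using \<alpha> by simp
  qed
  have "R x + ereal (inner v (z - x)) \<le> R z" for z
  proof (cases "R z = \<infinity>")
    case False
    then obtain rz where rz: "R z = ereal rz"
      using finite_R by blast
    define d where "d = B (z - x)"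
    define c where "c = inner v (z - x)"
    have d: "inner (y - B x) d = \<alpha> * c"
      by (simp only: d_def c_def v')
    have "0 \<le> t * (\<alpha> * (rz - rx - c)) + t\<^sup>2 * ((norm d)\<^sup>2 / 2)"
      if t: "0 < t" "t \<le> 1" for t
    proof -
      define u where "u = (1 - t) *\<^sub>R x + t *\<^sub>R z"
      have R_u: "R u \<le> ereal ((1 - t) * rx + t * rz)"
        using conv[unfolded convex_functional_def, rule_format, of "1 - t" t x z] t
        by (simp add: u_def rx rz)
      then obtain ru where ru: "R u = ereal ru"
        using finite_R[of u] by fastforce
      have "B u - y = (B x - y) + t *\<^sub>R d"
        by (simp add: u_def d_def blinfun.bilinear_simps algebra_simps)
      then have "(norm (B u - y))\<^sup>2
          = (norm (B x - y))\<^sup>2 - 2 * t * inner (y - B x) d + t\<^sup>2 * (norm d)\<^sup>2"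
        by (simp only: power2_norm_eq_inner)
          (simp add: inner_simps inner_commute algebra_simps power2_eq_square)
      moreover have "1 / 2 * (norm (B x - y))\<^sup>2 + \<alpha> * rx \<le> 1 / 2 * (norm (B u - y))\<^sup>2 + \<alpha> * ru"
        using B[of u] by (simp add: tikhonov_def rx ru)
      moreover have "\<alpha> * ru \<le> \<alpha> * ((1 - t) * rx + t * rz)"
        using R_u ru \<alpha> by (intro mult_left_mono) auto
      ultimately show ?thesis
        unfolding d by (simp add: algebra_simps)
    qed
    then have "0 \<le> \<alpha> * (rz - rx - c)"
      by (rule nonneg_if_quadratic_nonneg_near_0)
    then show ?thesis
      using \<alpha> by (simp add: rx rz zero_le_mult_iff flip: c_def)
  qed simp
  then have "v \<in> subdifferential R x"
    using \<open>R x \<noteq> \<infinity>\<close> by (simp add: subdifferential_def)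
  moreover have "\<alpha> * inner v x \<le> (norm y)\<^sup>2 / 4"
    using inner_diff_self_le[of y "B x"] by (simp add: v')
  ultimately show ?thesis
    by (auto simp: subgrad_feasible_def)
qed

lemma adp_feasible_if_subgrad_feasible:
  fixes R :: "'x::real_inner \<Rightarrow> ereal" and y :: "'y::real_inner"
  assumes nonneg: "\<And>x. 0 \<le> R x"
    and y_nz: "y \<noteq> 0"
    and \<alpha>: "\<alpha> > 0"
    and x: "x \<in> subgrad_feasible R \<alpha> y"
  shows "x \<in> adp_feasible R \<alpha> y"
proof -
  obtain v where v: "v \<in> subdifferential R x" and vx: "\<alpha> * inner v x \<le> (norm y)\<^sup>2 / 4"
    using x by (auto simp: subgrad_feasible_def)
  define t where "t = inner v x"
  define N where "N = (norm y)\<^sup>2"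
  define s where "s = sqrt (1 - 4 * \<alpha> * t / N)"
  \<comment> \<open>The root of \<open>N b (1 - b t) = \<alpha>\<close> in this form also covers the degenerate case \<open>t = 0\<close>.\<close>
  define b where "b = 2 * \<alpha> / (N * (1 + s))"
  have N: "N > 0" using y_nz by (simp add: N_def)
  have disc: "0 \<le> 1 - 4 * \<alpha> * t / N"
    using vx N by (simp add: t_def N_def field_simps)
  then have s: "0 \<le> s" "s\<^sup>2 = 1 - 4 * \<alpha> * t / N"
    by (simp_all add: s_def)
  have b: "b * N * (1 - b * t) = \<alpha>"
  proof -
    have s1: "1 + s \<noteq> 0" using s(1) by linarith
    have "b * N = 2 * \<alpha> / (1 + s)"
      using N by (simp add: b_def)
    moreover have "1 - b * t = (1 + s) / 2"
    proof -
      have "4 * \<alpha> * t / N = (1 - s) * (1 + s)"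
        using s(2) by (simp add: algebra_simps power2_eq_square)
      then have "4 * \<alpha> * t = (1 - s) * (1 + s) * N"
        using N by (simp only: divide_eq_eq)
      then have "2 * \<alpha> * t = (1 - s) / 2 * (N * (1 + s))"
        by (simp add: algebra_simps)
      then have "b * t = (1 - s) / 2"
        using s1 N unfolding b_def times_divide_eq_left by (simp only: divide_eq_eq) simp
      then show ?thesis by (simp add: field_simps)
    qed
    ultimately have "b * N * (1 - b * t) = 2 * \<alpha> / (1 + s) * ((1 + s) / 2)"
      by (simp only:)
    then show ?thesis using s1 by simp
  qed
  have lin: "bounded_linear (\<lambda>z. (b * inner v z) *\<^sub>R y)"
    by (intro bounded_linear_intros)
  define B :: "'x \<Rightarrow>\<^sub>L 'y" where "B = Blinfun (\<lambda>z. (b * inner v z) *\<^sub>R y)"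
  have B: "B z = (b * inner v z) *\<^sub>R y" for z
    unfolding B_def by (simp add: bounded_linear_Blinfun_apply[OF lin])
  have optimal: "inner (y - B x) (B z) = \<alpha> * inner v z" for z
  proof -
    have "inner (y - B x) (B z) = (b * N * (1 - b * t)) * inner v z"
      by (simp add: B inner_simps N_def t_def power2_norm_eq_inner algebra_simps)
    then show ?thesis by (simp only: b)
  qed
  have "R x \<noteq> \<infinity>"
    using v by (auto simp: subdifferential_def split: if_splits)
  then obtain rx where rx: "R x = ereal rx"
    using nonneg[of x] by (cases "R x") auto
  have "tikhonov R \<alpha> y B x \<le> tikhonov R \<alpha> y B z" for z
  proof (cases "R z")
    case (real rz)
    have "rx + inner v (z - x) \<le> rz"
      using v \<open>R x \<noteq> \<infinity>\<close> real rx by (auto simp: subdifferential_def dest: spec[of _ z])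
    then have "\<alpha> * (rx + inner v (z - x)) \<le> \<alpha> * rz"
      using \<alpha> by simp
    moreover have "(norm (B z - y))\<^sup>2
        = (norm (B x - y))\<^sup>2 - 2 * inner (y - B x) (B (z - x)) + (norm (B (z - x)))\<^sup>2"
      by (simp add: blinfun.bilinear_simps power2_norm_eq_inner inner_simps inner_commute
          algebra_simps)
    moreover have "0 \<le> (norm (B (z - x)))\<^sup>2" by simp
    ultimately have "1 / 2 * (norm (B x - y))\<^sup>2 + \<alpha> * rx \<le> 1 / 2 * (norm (B z - y))\<^sup>2 + \<alpha> * rz"
      unfolding optimal distrib_left by linarith
    then show ?thesis
      by (simp add: tikhonov_def rx real)
  next
    case PInf
    then show ?thesis using \<alpha> by (simp add: tikhonov_def)
  next
    case MInf
    then show ?thesis using nonneg[of z] by simp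
  qed
  then show ?thesis
    by (auto simp: adp_feasible_def is_arg_min_def not_less)
qed

theorem theorem3p3:
  fixes A :: "'x::{real_inner, complete_space} \<Rightarrow>\<^sub>L 'y::{real_inner, complete_space}"
    and R :: "'x \<Rightarrow> ereal"
    and y :: 'y
    and \<alpha> :: real
  assumes nonneg: "\<And>x. 0 \<le> R x"
    and conv: "convex_functional R"
    and coer: "coercive R"
    and wlsc: "weakly_lsc R"
    and proper: "\<exists>x. R x \<noteq> \<infinity>"
    and y_nz: "y \<noteq> 0"
    and \<alpha>_pos: "\<alpha> > 0"
  shows "subgrad_feasible R \<alpha> y = adp_feasible R \<alpha> y
    \<and> (\<forall>x. subgrad_solution A R \<alpha> y x \<longleftrightarrow> adp_solution A R \<alpha> y x)"
proof -
  have "subgrad_feasible R \<alpha> y = adp_feasible R \<alpha> y"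
    using adp_feasible_if_subgrad_feasible[of R y \<alpha>, OF nonneg y_nz \<alpha>_pos]
      subgrad_feasible_if_adp_feasible[of R \<alpha> _ y, OF nonneg conv proper \<alpha>_pos]
    by blast
  then show ?thesis
    by (simp add: subgrad_solution_def adp_solution_def)
qed

end
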